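(* Let $\sigma\ge0$, let $\mathcal D,\mathcal U\subset\mathbb R^3$ be bounded domains with $\mathrm{dist}(\mathcal U,\mathcal D)=r_0>0$. A function $\mu\in C_0^\infty(\mathcal D)$ with $\mu\ge0$ is uniquely determined by $$\tilde T(x)=\frac1{2^4\pi^2}\int_{\mathbb R^3}\frac{e^{-\sigma|x-y|}}{|x-y|^2}\mu(y)\,dy,\qquad x\in\mathcal U.$$ That is, if $\mu_1,\mu_2\in C_0^\infty(\mathcal D)$ are nonnegative and the corresponding functions $\tilde T_1,\tilde T_2$ satisfy $\tilde T_1(x)=\tilde T_2(x)$ for all $x\in\mathcal U$, then $\mu_1=\mu_2$.
   Context: A domain is a nonempty connected open set; $C_0^\infty(\mathcal D)$ is the space of smooth (real-valued) functions with compact support in $\mathcal D$. The number $\sigma$ is fixed and known. *)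

theory Defs
  imports "HOL-Analysis.Analysis"
begin

definition is_domain :: "'a::topological_space set \<Rightarrow> bool" where
  "is_domain D \<longleftrightarrow> D \<noteq> {} \<and> open D \<and> connected D"

text \<open>\<open>C_k k f\<close>: the function \<open>f\<close> is \<open>k\<close> times continuously differentiable on the whole space,
  by recursion on its partial derivatives along the standard basis.\<close>

primrec C_k :: "nat \<Rightarrow> ('a::euclidean_space \<Rightarrow> real) \<Rightarrow> bool" where
  "C_k 0 f \<longleftrightarrow> continuous_on UNIV f"
| "C_k (Suc k) f \<longleftrightarrow>
     f differentiable_on UNIV \<and> (\<forall>b\<in>Basis. C_k k (\<lambda>x. frechet_derivative f (at x) b))"

definition smooth :: "('a::euclidean_space \<Rightarrow> real) \<Rightarrow> bool" where
  "smooth f \<longleftrightarrow> (\<forall>k. C_k k f)"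

text \<open>The space $C_0^\infty(D)$. Its elements are regarded as functions on the whole space,
  extended by zero outside \<open>D\<close>; as the support is a compact subset of the open set \<open>D\<close>,
  smoothness on \<open>D\<close> and smoothness of the extension amount to the same.\<close>

definition test_functions :: "'a::euclidean_space set \<Rightarrow> ('a \<Rightarrow> real) set" where
  "test_functions D =
     {f. smooth f \<and> compact (closure (support_on UNIV f)) \<and> closure (support_on UNIV f) \<subseteq> D}"

text \<open>At the single point \<open>y = x\<close>, a null set, the integrand has the conventional value 0.\<close>

definition T_tilde :: "real \<Rightarrow> (real^3 \<Rightarrow> real) \<Rightarrow> real^3 \<Rightarrow> real" where
  "T_tilde \<sigma> \<mu> x =
     1 / (2 ^ 4 * pi\<^sup>2) * (\<integral>y. exp (- \<sigma> * norm (x - y)) / (norm (x - y))\<^sup>2 * \<mu> y \<partial>lborel)"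

end

theory Submission
  imports Defs "HOL-Complex_Analysis.Complex_Analysis"
begin

text \<open>Let \<open>\<mu> = \<mu>\<^sub>1 - \<mu>\<^sub>2\<close>, \<open>r = |x - y|\<close> and \<open>g r = exp (- \<sigma> r) / r\<close>, so that \<open>\<integral> g(r)/r d\<mu>(y) = 0\<close> for
  \<open>x \<in> U\<close>. As \<open>\<Delta> (f(r)/r) = f''(r)/r\<close> in three dimensions, applying powers of the Laplacian
  gives \<open>\<integral> g\<^sup>(\<^sup>2\<^sup>k\<^sup>)(r)/r d\<mu> = 0\<close> for all \<open>k\<close>. Hence all derivatives at \<open>t = 0\<close> of
  \<open>h(t) = \<integral> (g(r + t) + g(r - t))/r d\<mu>\<close> vanish; \<open>h\<close> is holomorphic on the strip \<open>|Re t| < r\<^sub>0\<close>,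
  so it vanishes there, in particular on the imaginary axis. At \<open>t = i\<tau>\<close> with \<open>sin (\<sigma>\<tau>) = 0\<close> this
  reads \<open>\<integral> exp (- \<sigma> r)/(r\<^sup>2 + \<tau>\<^sup>2) d\<mu> = 0\<close>. Letting \<open>\<tau>\<close> tend to infinity along such values, one
  obtains successively \<open>\<integral> exp (- \<sigma> r) r\<^sup>2\<^sup>j d\<mu> = 0\<close> for all \<open>j\<close>, and by the Weierstrass theorem
  \<open>\<integral> G(r\<^sup>2) d\<mu> = 0\<close> for all continuous \<open>G\<close>, still for \<open>x \<in> U\<close>. For \<open>G(u) = u\<^sup>k\<close> the integral is a
  polynomial in \<open>x\<close>, so it vanishes for every \<open>x\<close> in space. Applying the Weierstrass theorem once more,
  the same holds for all continuous \<open>G\<close>, and bump functions \<open>G\<close> give \<open>\<mu> x = 0\<close>. No point of \<open>U\<close>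
  needs to be joined to infinity outside the support, so \<open>U\<close> may lie in a cavity of \<open>D\<close>.\<close>

section \<open>Integration against a compactly supported density\<close>

locale compact_density =
  fixes \<mu> :: "'b::euclidean_space \<Rightarrow> real" and D :: "'b set" and a b :: 'b
  assumes continuous_density: "continuous_on UNIV \<mu>"
    and open_D: "open D"
    and support_D: "closure (support_on UNIV \<mu>) \<subseteq> D"
    and support_box: "closure (support_on UNIV \<mu>) \<subseteq> box a b"
begin

text \<open>The box contains the support, so this is the integral over the whole space, in the form
  to which the Leibniz rule on compact boxes applies. Real and complex kernels share the definition.
  Since \<open>\<mu>\<close> vanishes off \<open>D\<close>, singularities of \<open>f\<close>
  outside \<open>D\<close> do no harm.\<close>

definition wint :: "('b \<Rightarrow> 'a::{real_normed_field,banach}) \<Rightarrow> 'a"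
  where "wint f = integral (cbox a b) (\<lambda>y. f y * of_real (\<mu> y))"

lemma density_eq_0: "y \<notin> closure (support_on UNIV \<mu>) \<Longrightarrow> \<mu> y = 0"
  using closure_subset[of "support_on UNIV \<mu>"] by (auto simp: support_on_def)

lemma density_eq_0_D: "y \<notin> D \<Longrightarrow> \<mu> y = 0"
  using density_eq_0 support_D by blast

text \<open>Two relatively open sets cover the product: on \<open>A \<times> D\<close> both factors
  are continuous, and over the complement of the support the product is 0.\<close>

lemma continuous_on_weighted_Times:
  fixes f :: "'c::topological_space \<Rightarrow> 'b \<Rightarrow> 'a::real_normed_field"
  assumes "continuous_on (A \<times> D) (\<lambda>(t, y). f t y)"
  shows "continuous_on (A \<times> UNIV) (\<lambda>(t, y). f t y * of_real (\<mu> y))"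
proof -
  let ?K = "closure (support_on UNIV \<mu>)"
  have eq: "A \<times> UNIV = A \<times> D \<union> A \<times> (- ?K)"
    using support_D by auto
  have open': "openin (top_of_set (A \<times> UNIV)) (A \<times> V)" if "open V" for V :: "'b set"
    using that by (intro openin_Times) auto
  have "continuous_on (A \<times> D \<union> A \<times> (- ?K)) (\<lambda>(t, y). f t y * of_real (\<mu> y))"
  proof (rule continuous_on_Un_local_open)
    show "openin (top_of_set (A \<times> D \<union> A \<times> (- ?K))) (A \<times> D)"
      unfolding eq[symmetric] by (rule open'[OF open_D])
    show "openin (top_of_set (A \<times> D \<union> A \<times> (- ?K))) (A \<times> (- ?K))"
      unfolding eq[symmetric] by (rule open') auto
    have \<mu>: "continuous_on (A \<times> D) (\<lambda>p. \<mu> (snd p))"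
      by (rule continuous_on_compose2[OF continuous_density]) (auto intro!: continuous_intros)
    show "continuous_on (A \<times> D) (\<lambda>(t, y). f t y * of_real (\<mu> y))"
      using assms \<mu> by (auto simp: split_beta intro!: continuous_intros)
    have "continuous_on (A \<times> (- ?K)) (\<lambda>p. 0 :: 'a)"
      by auto
    then show "continuous_on (A \<times> (- ?K)) (\<lambda>(t, y). f t y * of_real (\<mu> y))"
      by (rule continuous_on_cong[THEN iffD1, rotated -1]) (auto simp: density_eq_0)
  qed
  then show ?thesis
    by (simp add: eq)
qed

lemma continuous_on_weighted:
  fixes f :: "'b \<Rightarrow> 'a::real_normed_field"
  assumes "continuous_on D f"
  shows "continuous_on UNIV (\<lambda>y. f y * of_real (\<mu> y))"
proof -
  have "continuous_on ({0::real} \<times> D) (\<lambda>(t, y). f y)"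
    unfolding split_beta by (rule continuous_on_compose2[OF assms]) (auto intro!: continuous_intros)
  from continuous_on_compose2[OF continuous_on_weighted_Times[OF this], of UNIV "\<lambda>y. (0, y)"]
  show ?thesis
    by (simp add: continuous_on_Pair image_subset_iff)
qed

lemma weighted_integrable:
  fixes f :: "'b \<Rightarrow> 'a::{real_normed_field,banach}"
  assumes "continuous_on D f"
  shows "(\<lambda>y. f y * of_real (\<mu> y)) integrable_on cbox a b"
  by (rule integrable_continuous, rule continuous_on_subset[OF continuous_on_weighted[OF assms]]) auto

lemma wint_cong: "(\<And>y. y \<in> D \<Longrightarrow> f y = g y) \<Longrightarrow> wint f = wint g"
  unfolding wint_def by (rule integral_cong) (use density_eq_0_D in force)

lemma wint_diff:
  assumes "continuous_on D f" "continuous_on D g"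
  shows "wint (\<lambda>y. f y - g y) = wint f - wint g"
  unfolding wint_def left_diff_distrib
  by (rule integral_diff) (use assms weighted_integrable in auto)

lemma wint_mult_left: "wint (\<lambda>y. c * f y) = c * wint f"
  for c :: "'a::{real_normed_field,banach}"
  by (simp add: wint_def mult.assoc)

lemma wint_sum:
  assumes "finite I" "\<And>i. i \<in> I \<Longrightarrow> continuous_on D (f i)"
  shows "wint (\<lambda>y. \<Sum>i\<in>I. f i y) = (\<Sum>i\<in>I. wint (f i))"
  unfolding wint_def sum_distrib_right
  by (rule integral_sum) (use assms weighted_integrable in auto)

lemma wint_of_real:
  assumes "continuous_on D f"
  shows "wint (\<lambda>y. complex_of_real (f y)) = of_real (wint f)"
  unfolding wint_def
  using integral_linear[OF weighted_integrable[OF assms] bounded_linear_of_real[where 'a = complex]]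
  by (simp add: o_def)

lemma wint_Re:
  assumes "continuous_on D f"
  shows "wint (\<lambda>y. Re (f y)) = Re (wint f)"
  unfolding wint_def
  using integral_linear[OF weighted_integrable[OF assms] bounded_linear_Re] by (simp add: o_def)

lemma wint_Im:
  assumes "continuous_on D f"
  shows "wint (\<lambda>y. Im (f y)) = Im (wint f)"
  unfolding wint_def
  using integral_linear[OF weighted_integrable[OF assms] bounded_linear_Im] by (simp add: o_def)

lemma wint_bound:
  assumes "continuous_on D f"
    and "\<And>y. y \<in> closure (support_on UNIV \<mu>) \<Longrightarrow> norm (f y) \<le> B"
  shows "norm (wint f) \<le> B * integral (cbox a b) (\<lambda>y. \<bar>\<mu> y\<bar>)"
proof -
  have "norm (wint f) \<le> integral (cbox a b) (\<lambda>y. B * \<bar>\<mu> y\<bar>)"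
    unfolding wint_def
  proof (rule integral_norm_bound_integral)
    show "(\<lambda>y. B * \<bar>\<mu> y\<bar>) integrable_on cbox a b"
      by (intro integrable_continuous continuous_intros continuous_on_subset[OF continuous_density]) auto
    fix y
    show "norm (f y * of_real (\<mu> y)) \<le> B * \<bar>\<mu> y\<bar>"
      using assms(2)[of y] density_eq_0[of y]
      by (cases "y \<in> closure (support_on UNIV \<mu>)") (auto simp: norm_mult mult_right_mono)
  qed (rule weighted_integrable[OF assms(1)])
  then show ?thesis
    by simp
qed

lemma compact_support: "compact (closure (support_on UNIV \<mu>))"
  using support_box bounded_box bounded_subset compact_eq_bounded_closed by blast

text \<open>Differentiability of \<open>f\<close> is asked for on \<open>D\<close> only: at the
  other points of the box the weighted integrand is identically 0.\<close>

lemma wint_leibniz: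
  assumes "\<And>t y. t \<in> A \<Longrightarrow> y \<in> D \<Longrightarrow> ((\<lambda>t. f t y) has_field_derivative f' t y) (at t within A)"
    and "\<And>t. t \<in> A \<Longrightarrow> continuous_on D (f t)"
    and "continuous_on (A \<times> D) (\<lambda>(t, y). f' t y)"
    and "t \<in> A" "convex A"
  shows "((\<lambda>t. wint (f t)) has_field_derivative wint (f' t)) (at t within A)"
  unfolding wint_def
proof (rule leibniz_rule_field_derivative[where U = A])
  fix t y assume t: "t \<in> A"
  show "((\<lambda>t. f t y * of_real (\<mu> y)) has_field_derivative f' t y * of_real (\<mu> y)) (at t within A)"
    using assms(1)[OF t, of y] density_eq_0_D[of y]
    by (cases "y \<in> D") (auto intro!: derivative_eq_intros)
next
  show "continuous_on (A \<times> cbox a b) (\<lambda>(t, y). f' t y * of_real (\<mu> y))"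
    by (rule continuous_on_subset[OF continuous_on_weighted_Times[OF assms(3)]]) auto
qed (use assms weighted_integrable in auto)

text \<open>Links the box integral to the Lebesgue integral that occurs in \<open>T_tilde\<close>:
  multiplying by the indicator of the box does not change an integrand that is 0 off the
  support.\<close>

lemma wint_eq_lborel:
  fixes f :: "'b \<Rightarrow> real"
  assumes "continuous_on D f"
  shows "integrable lborel (\<lambda>y. f y * \<mu> y)" "wint f = (\<integral>y. f y * \<mu> y \<partial>lborel)"
proof -
  have c: "continuous_on UNIV (\<lambda>y. f y * \<mu> y)"
    using continuous_on_weighted[OF assms] by simp
  have ind: "indicator (cbox a b) y *\<^sub>R (f y * \<mu> y) = f y * \<mu> y" for y
    using density_eq_0[of y] support_box box_subset_cbox by (fastforce simp: indicator_def)
  have s: "set_integrable lborel (cbox a b) (\<lambda>y. f y * \<mu> y)"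
    unfolding set_integrable_def
    by (rule borel_integrable_compact) (use c continuous_on_subset in auto)
  from s show "integrable lborel (\<lambda>y. f y * \<mu> y)"
    by (simp only: set_integrable_def ind)
  show "wint f = (\<integral>y. f y * \<mu> y \<partial>lborel)"
    using set_borel_integral_eq_integral(2)[OF s] by (simp only: wint_def set_lebesgue_integral_def ind of_real_eq_id id_apply)
qed

text \<open>On the compact image of the support under \<open>u\<close>, \<open>G\<close> is a
  uniform limit of polynomials, and for a polynomial the integral is a combination of the vanishing
  moments.\<close>

lemma wint_polynomial_density:
  fixes \<omega> u :: "'b \<Rightarrow> real"
  assumes \<omega>: "continuous_on D \<omega>" and u: "continuous_on D u"
    and moments: "\<And>j. wint (\<lambda>y. \<omega> y * u y ^ j) = 0"
    and G: "continuous_on (u ` D) G"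
  shows "wint (\<lambda>y. \<omega> y * G (u y)) = 0"
proof -
  let ?K = "closure (support_on UNIV \<mu>)"
  define C where "C = integral (cbox a b) (\<lambda>y. \<bar>\<mu> y\<bar>)"
  have C: "C \<ge> 0"
    unfolding C_def
    by (intro integral_nonneg integrable_continuous continuous_intros continuous_on_subset[OF continuous_density]) auto
  have cG: "continuous_on D (\<lambda>y. G (u y))"
    by (rule continuous_on_compose2[OF G u]) auto
  obtain W where W: "W > 0" "\<And>y. y \<in> ?K \<Longrightarrow> \<bar>\<omega> y\<bar> \<le> W"
  proof -
    have "bounded (\<omega> ` ?K)"
      using compact_continuous_image[OF continuous_on_subset[OF \<omega> support_D] compact_support]
      by (rule compact_imp_bounded)
    then show thesis
      using that unfolding bounded_pos by auto
  qed
  have "\<bar>wint (\<lambda>y. \<omega> y * G (u y))\<bar> \<le> e" if e: "e > 0" for e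
  proof -
    have WC: "W * C \<ge> 0" using W C by simp
    \<comment> \<open>The summand 1 keeps the denominator positive even if \<open>W * C = 0\<close>;
      the final error \<open>W * C * d\<close> is still at most \<open>e\<close>.\<close>
    define d where "d = e / (W * C + 1)"
    have d: "d > 0" using e WC by (simp add: d_def)
    have "compact (u ` ?K)"
      using compact_continuous_image[OF continuous_on_subset[OF u support_D] compact_support] .
    moreover have "continuous_on (u ` ?K) G"
      by (rule continuous_on_subset[OF G]) (use support_D in auto)
    ultimately obtain p where p: "real_polynomial_function p" "\<And>x. x \<in> u ` ?K \<Longrightarrow> \<bar>G x - p x\<bar> < d"
      using Stone_Weierstrass_real_polynomial_function d by blast
    obtain c n where pc: "p = (\<lambda>x. \<Sum>i\<le>n. c i * x ^ i)"
      using p(1) real_polynomial_function_iff_sum by blast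
    have cp: "continuous_on D (\<lambda>y. \<omega> y * p (u y))"
      unfolding pc by (intro continuous_intros \<omega> u)
    have "wint (\<lambda>y. \<omega> y * p (u y)) = wint (\<lambda>y. \<Sum>i\<le>n. c i * (\<omega> y * u y ^ i))"
      by (simp add: pc sum_distrib_left mult_ac)
    also have "\<dots> = 0"
      by (subst wint_sum) (auto intro!: continuous_intros \<omega> u simp: wint_mult_left moments)
    finally have "wint (\<lambda>y. \<omega> y * G (u y)) = wint (\<lambda>y. \<omega> y * G (u y) - \<omega> y * p (u y))"
      by (subst wint_diff) (auto intro!: continuous_intros \<omega> cG cp)
    also have "norm \<dots> \<le> (W * d) * C"
      unfolding C_def
    proof (rule wint_bound)
      show "continuous_on D (\<lambda>y. \<omega> y * G (u y) - \<omega> y * p (u y))"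
        by (auto intro!: continuous_intros \<omega> cG cp)
      fix y assume y: "y \<in> ?K"
      have "norm (\<omega> y * G (u y) - \<omega> y * p (u y)) = \<bar>\<omega> y\<bar> * \<bar>G (u y) - p (u y)\<bar>"
        by (simp add: right_diff_distrib[symmetric] abs_mult)
      also have "\<dots> \<le> W * d"
        using W(1) W(2)[OF y] p(2)[of "u y"] y by (intro mult_mono) auto
      finally show "norm (\<omega> y * G (u y) - \<omega> y * p (u y)) \<le> W * d" .
    qed
    also have "(W * d) * C = (W * C) * d" by simp
    also have "\<dots> \<le> e"
      using e WC by (simp add: d_def field_simps)
    finally show ?thesis by simp
  qed
  then have "\<bar>wint (\<lambda>y. \<omega> y * G (u y))\<bar> \<le> 0"
    by (rule field_le_epsilon[of _ 0, simplified])
  then show ?thesis by simp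
qed

section \<open>The Laplacian acting on radial kernels\<close>

text \<open>The integral vanishes on the open set \<open>U\<close>, hence along a short segment
  through \<open>x\<close> in direction \<open>v\<close>, and so does its derivative. As
  \<open>U\<close> misses \<open>D\<close>, the argument of \<open>k\<close> stays away from the
  singularity at 0, which permits differentiation under the integral.\<close>

lemma wint_directional_derivative:
  fixes k k' :: "'b \<Rightarrow> real"
  assumes "open U" "U \<inter> D = {}"
    and deriv: "\<And>z. z \<noteq> 0 \<Longrightarrow> ((\<lambda>s. k (z + s *\<^sub>R v)) has_field_derivative k' z) (at 0)"
    and k: "continuous_on (- {0}) k" and k': "continuous_on (- {0}) k'"
    and zero: "\<And>x. x \<in> U \<Longrightarrow> wint (\<lambda>y. k (x - y)) = 0"
    and x: "x \<in> U"
  shows "wint (\<lambda>y. k' (x - y)) = 0"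
proof -
  obtain e where e: "e > 0" "ball x e \<subseteq> U"
    using \<open>open U\<close> x openE by blast
  \<comment> \<open>Guarantees \<open>\<bar>s\<bar> * norm v < e\<close> for
    \<open>\<bar>s\<bar> < d\<close>; the summand 1 covers \<open>v = 0\<close>.\<close>
  define d where "d = e / (norm v + 1)"
  have d: "d > 0"
    using e by (simp add: d_def add_nonneg_pos)
  define A where "A = {-d<..<d}"
  have inU: "x + s *\<^sub>R v \<in> U" if "s \<in> A" for s
  proof -
    have "\<bar>s\<bar> * (norm v + 1) < e"
      using that pos_less_divide_eq[of "norm v + 1" "\<bar>s\<bar>" e]
      by (auto simp: A_def d_def abs_less_iff add_nonneg_pos)
    then have "norm (s *\<^sub>R v) < e"
      by (simp add: distrib_left)
    then show ?thesis
      using e(2) by (auto simp: dist_norm)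
  qed
  have ne: "x + s *\<^sub>R v - y \<noteq> 0" if "s \<in> A" "y \<in> D" for s y
    using inU[OF that(1)] that(2) \<open>U \<inter> D = {}\<close> by auto
  have "((\<lambda>s. wint (\<lambda>y. k (x + s *\<^sub>R v - y))) has_field_derivative wint (\<lambda>y. k' (x + 0 *\<^sub>R v - y))) (at 0 within A)"
  proof (rule wint_leibniz)
    fix s y assume sy: "s \<in> A" "y \<in> D"
    have "((\<lambda>r. k (x + (r + s) *\<^sub>R v - y)) has_field_derivative k' (x + s *\<^sub>R v - y)) (at 0)"
      using deriv[OF ne[OF sy]] by (simp add: algebra_simps)
    then have "((\<lambda>r. k (x + r *\<^sub>R v - y)) has_field_derivative k' (x + s *\<^sub>R v - y)) (at (0 + s))"
      by (subst DERIV_shift)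
    then show "((\<lambda>s. k (x + s *\<^sub>R v - y)) has_field_derivative k' (x + s *\<^sub>R v - y)) (at s within A)"
      by (simp add: has_field_derivative_at_within)
  next
    fix s assume "s \<in> A"
    then show "continuous_on D (\<lambda>y. k (x + s *\<^sub>R v - y))"
      using ne by (intro continuous_on_compose2[OF k] continuous_intros) auto
  next
    show "continuous_on (A \<times> D) (\<lambda>(s, y). k' (x + s *\<^sub>R v - y))"
      unfolding split_beta using ne by (intro continuous_on_compose2[OF k'] continuous_intros) auto
  qed (use d in \<open>auto simp: A_def\<close>)
  then have "((\<lambda>s. wint (\<lambda>y. k (x + s *\<^sub>R v - y))) has_field_derivative wint (\<lambda>y. k' (x - y))) (at 0)"
    using d at_within_open[of 0 A] by (simp add: A_def)
  moreover have "((\<lambda>s. wint (\<lambda>y. k (x + s *\<^sub>R v - y))) has_field_derivative 0) (at 0)"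
  proof (rule has_field_derivative_transform_within_open[OF DERIV_const[where k = 0], where S = A])
    show "0 = wint (\<lambda>y. k (x + s *\<^sub>R v - y))" if "s \<in> A" for s
      using zero[OF inU[OF that]] by simp
  qed (use d in \<open>auto simp: A_def\<close>)
  ultimately show ?thesis
    by (rule DERIV_unique)
qed

lemma DERIV_norm_line:
  fixes z v :: "'c::real_inner"
  assumes "z \<noteq> 0"
  shows "((\<lambda>s. norm (z + s *\<^sub>R v)) has_field_derivative (z \<bullet> v) / norm z) (at 0)"
proof -
  have "((\<lambda>s. sqrt ((z \<bullet> z) + 2 * s * (z \<bullet> v) + s\<^sup>2 * (v \<bullet> v))) has_field_derivative (z \<bullet> v) / norm z) (at 0)"
    using assms by (auto intro!: derivative_eq_intros simp: norm_eq_sqrt_inner field_simps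
        elim!: notE[OF leD[OF inner_ge_zero]])
  moreover have "norm (z + s *\<^sub>R v) = sqrt ((z \<bullet> z) + 2 * s * (z \<bullet> v) + s\<^sup>2 * (v \<bullet> v))" for s
    by (simp add: norm_eq_sqrt_inner algebra_simps inner_commute power2_eq_square)
  ultimately show ?thesis
    by simp
qed

text \<open>Differentiating twice along each basis vector and summing applies the Laplacian to the
  kernel \<open>f r / r\<close>, which in dimension 3 yields \<open>f2 r / r\<close>.\<close>

lemma wint_laplacian_radial:
  fixes f f1 f2 :: "real \<Rightarrow> real"
  assumes dim: "DIM('b) = 3"
    and U: "open U" "U \<inter> D = {}"
    and f: "\<And>r. r > 0 \<Longrightarrow> (f has_field_derivative f1 r) (at r)"
    and f1: "\<And>r. r > 0 \<Longrightarrow> (f1 has_field_derivative f2 r) (at r)"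
    and f2: "continuous_on {0<..} f2"
    and zero: "\<And>x. x \<in> U \<Longrightarrow> wint (\<lambda>y. f (norm (x - y)) / norm (x - y)) = 0"
    and x: "x \<in> U"
  shows "wint (\<lambda>y. f2 (norm (x - y)) / norm (x - y)) = 0"
proof -
  \<comment> \<open>The derivative of \<open>f r / r\<close> is \<open>r * h r\<close>, so the
    kernel has gradient \<open>h (norm z)\<close> times \<open>z\<close>; \<open>h1\<close> is the
    derivative of \<open>h\<close>.\<close>
  define h where "h = (\<lambda>r. f1 r / r\<^sup>2 - f r / r ^ 3)"
  define h1 where "h1 = (\<lambda>r. f2 r / r\<^sup>2 - 3 * f1 r / r ^ 3 + 3 * f r / r ^ 4)"
  have q: "((\<lambda>r. f r / r) has_field_derivative r * h r) (at r)" if "r > 0" for r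
    using that by (auto intro!: derivative_eq_intros f simp: h_def field_simps power2_eq_square power3_eq_cube)
  have h: "(h has_field_derivative h1 r) (at r)" if "r > 0" for r
    unfolding h_def using that
    by (auto intro!: derivative_eq_intros f f1 simp: h1_def field_simps power_numeral_reduce)
  have cf: "continuous_on {0<..} f" "continuous_on {0<..} f1"
    using f f1 by (auto intro!: continuous_at_imp_continuous_on DERIV_isCont)
  have ch: "continuous_on {0<..} h" "continuous_on {0<..} h1"
    unfolding h_def h1_def by (auto intro!: continuous_intros cf f2)
  have cn: "continuous_on (- {0}) (\<lambda>z::'b. \<phi> (norm z))" if "continuous_on {0<..} \<phi>" for \<phi> :: "real \<Rightarrow> real"
    by (rule continuous_on_compose2[OF that]) (auto intro!: continuous_intros)
  have cD: "continuous_on D (\<lambda>y. \<phi> (x - y))" if "continuous_on (- {0}) \<phi>" for \<phi> :: "'b \<Rightarrow> real"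
    by (rule continuous_on_compose2[OF that]) (use x U in \<open>auto intro!: continuous_intros\<close>)
  have rad: "((\<lambda>s. \<phi> (norm (z + s *\<^sub>R v))) has_field_derivative c * ((z \<bullet> v) / norm z)) (at 0)"
    if "z \<noteq> 0" "(\<phi> has_field_derivative c) (at (norm z))" for z v :: 'b and \<phi> :: "real \<Rightarrow> real" and c
    by (rule DERIV_chain2[where f = \<phi>]) (use that DERIV_norm_line in auto)
  \<comment> \<open>The second derivative of the kernel \<open>f (norm z) / norm z\<close> along
    \<open>v\<close>.\<close>
  define k2 where "k2 = (\<lambda>v z::'b. h (norm z) * (v \<bullet> v) + h1 (norm z) * (z \<bullet> v)\<^sup>2 / norm z)"
  have ck2: "continuous_on (- {0}) (k2 v)" for v
    unfolding k2_def by (auto intro!: continuous_intros cn ch)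
  have k1: "wint (\<lambda>y. h (norm (x - y)) * ((x - y) \<bullet> v)) = 0" if "x \<in> U" for x v
  proof (rule wint_directional_derivative[OF U, where k = "\<lambda>z. f (norm z) / norm z" and v = v
        and k' = "\<lambda>z. h (norm z) * (z \<bullet> v)"])
    fix z :: 'b assume z: "z \<noteq> 0"
    show "((\<lambda>s. f (norm (z + s *\<^sub>R v)) / norm (z + s *\<^sub>R v)) has_field_derivative h (norm z) * (z \<bullet> v)) (at 0)"
      using rad[OF z q[of "norm z"], of v] z by (simp add: mult_ac)
  qed (use zero that in \<open>auto intro!: continuous_intros cn cf ch\<close>)
  have "wint (\<lambda>y. k2 v (x - y)) = 0" for v
  proof (rule wint_directional_derivative[OF U, where k = "\<lambda>z. h (norm z) * (z \<bullet> v)" and v = v and k' = "k2 v"])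
    fix z :: 'b assume z: "z \<noteq> 0"
    have "((\<lambda>s. h (norm (z + s *\<^sub>R v)) * ((z + s *\<^sub>R v) \<bullet> v)) has_field_derivative
        h1 (norm z) * ((z \<bullet> v) / norm z) * (z \<bullet> v) + (v \<bullet> v) * h (norm z)) (at 0)"
      using rad[OF z h[of "norm z"], of v] z
      by (auto intro!: derivative_eq_intros simp: inner_add_left)
    then show "((\<lambda>s. h (norm (z + s *\<^sub>R v)) * ((z + s *\<^sub>R v) \<bullet> v)) has_field_derivative k2 v z) (at 0)"
      by (simp add: k2_def power2_eq_square algebra_simps)
  qed (use k1 x in \<open>auto intro!: continuous_intros cn ch ck2\<close>)
  then have "wint (\<lambda>y. \<Sum>v\<in>Basis. k2 v (x - y)) = 0"
    by (subst wint_sum) (auto intro!: cD ck2)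
  \<comment> \<open>The trace is \<open>3 * h r + r * h1 r\<close>, with 3 the number of basis
    vectors; all terms in \<open>f\<close> and \<open>f1\<close> cancel.\<close>
  moreover have "(\<Sum>v\<in>Basis. k2 v z) = f2 (norm z) / norm z" if "z \<noteq> 0" for z
  proof -
    have "(\<Sum>v\<in>Basis. k2 v z) = (\<Sum>v\<in>(Basis::'b set). h (norm z)) + h1 (norm z) / norm z * (\<Sum>v\<in>Basis. (z \<bullet> v)\<^sup>2)"
      by (simp add: k2_def sum.distrib sum_distrib_left inner_Basis)
    also have "(\<Sum>v\<in>Basis. (z \<bullet> v)\<^sup>2) = (norm z)\<^sup>2"
      unfolding power2_norm_eq_inner euclidean_inner[of z z] by (simp add: power2_eq_square)
    also have "(\<Sum>v\<in>(Basis::'b set). h (norm z)) + h1 (norm z) / norm z * (norm z)\<^sup>2 = f2 (norm z) / norm z"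
      using that dim by (simp add: h_def h1_def field_simps power_numeral_reduce)
    finally show ?thesis .
  qed
  ultimately show ?thesis
    using x U by (subst wint_cong[where g = "\<lambda>y. \<Sum>v\<in>Basis. k2 v (x - y)"])
      (metis disjoint_iff right_minus_eq)+
qed

section \<open>Holomorphic kernels and the wave equation\<close>

lemma has_real_derivative_Re_Im:
  assumes "(G has_field_derivative d) (at (of_real r))"
  shows "((\<lambda>r. Re (G (of_real r))) has_field_derivative Re d) (at r)"
    and "((\<lambda>r. Im (G (of_real r))) has_field_derivative Im d) (at r)"
  using bounded_linear.has_vector_derivative[OF bounded_linear_Re has_vector_derivative_real_field[OF assms]]
    bounded_linear.has_vector_derivative[OF bounded_linear_Im has_vector_derivative_real_field[OF assms]]
  by (auto simp: has_real_derivative_iff_has_vector_derivative)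

text \<open>On the positive real axis the real and imaginary parts of \<open>G\<close> are real
  functions whose derivatives are the parts of the complex derivatives, so the radial result applies
  to each.\<close>

lemma wint_laplacian_holomorphic:
  assumes dim: "DIM('b) = 3"
    and U: "open U" "U \<inter> D = {}"
    and G: "G holomorphic_on {z. Re z > 0}"
    and zero: "\<And>x. x \<in> U \<Longrightarrow> wint (\<lambda>y. G (of_real (norm (x - y))) / of_real (norm (x - y))) = 0"
    and x: "x \<in> U"
  shows "wint (\<lambda>y. deriv (deriv G) (of_real (norm (x - y))) / of_real (norm (x - y))) = 0"
proof -
  let ?H = "{z. Re z > 0}"
  have H: "open ?H"
    by (rule open_halfspace_Re_gt)
  have hol: "deriv G holomorphic_on ?H" "deriv (deriv G) holomorphic_on ?H"
    by (intro holomorphic_deriv G H)+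
  have d: "(G has_field_derivative deriv G (of_real r)) (at (of_real r))"
    "(deriv G has_field_derivative deriv (deriv G) (of_real r)) (at (of_real r))" if "r > 0" for r
    using holomorphic_derivI[OF G H] holomorphic_derivI[OF hol(1) H] that by auto
  have c: "continuous_on {0<..} (\<lambda>r. F (complex_of_real r))" if "F holomorphic_on ?H" for F
    by (rule continuous_on_compose2[OF holomorphic_on_imp_continuous_on[OF that]])
      (auto intro!: continuous_intros)
  have cD: "continuous_on D (\<lambda>y. F (complex_of_real (norm (x - y))) / of_real (norm (x - y)))"
    if "F holomorphic_on ?H" "x \<in> U" for F x
    by (intro continuous_on_divide continuous_intros continuous_on_compose2[OF c[OF that(1)]])
      (use U that(2) in auto)
  have re: "wint (\<lambda>y. Re (F (of_real (norm (x - y)))) / norm (x - y)) =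
      Re (wint (\<lambda>y. F (of_real (norm (x - y))) / of_real (norm (x - y))))"
    and im: "wint (\<lambda>y. Im (F (of_real (norm (x - y)))) / norm (x - y)) =
      Im (wint (\<lambda>y. F (of_real (norm (x - y))) / of_real (norm (x - y))))"
    if "F holomorphic_on ?H" "x \<in> U" for F x
    using wint_Re[OF cD[OF that]] wint_Im[OF cD[OF that]] by simp_all
  have "wint (\<lambda>y. Re (deriv (deriv G) (of_real (norm (x - y)))) / norm (x - y)) = 0"
    by (rule wint_laplacian_radial[OF dim U has_real_derivative_Re_Im(1)[OF d(1)] has_real_derivative_Re_Im(1)[OF d(2)]])
      (use re[OF G] zero x in \<open>auto intro!: continuous_intros c hol\<close>)
  moreover have "wint (\<lambda>y. Im (deriv (deriv G) (of_real (norm (x - y)))) / norm (x - y)) = 0"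
    by (rule wint_laplacian_radial[OF dim U has_real_derivative_Re_Im(2)[OF d(1)] has_real_derivative_Re_Im(2)[OF d(2)]])
      (use im[OF G] zero x in \<open>auto intro!: continuous_intros c hol\<close>)
  ultimately show ?thesis
    using re[OF hol(2) x] im[OF hol(2) x] by (simp add: complex_eq_iff)
qed

lemma wint_higher_deriv_even:
  assumes "DIM('b) = 3" "open U" "U \<inter> D = {}"
    and G: "G holomorphic_on {z. Re z > 0}"
    and zero: "\<And>x. x \<in> U \<Longrightarrow> wint (\<lambda>y. G (of_real (norm (x - y))) / of_real (norm (x - y))) = 0"
    and "x \<in> U"
  shows "wint (\<lambda>y. (deriv ^^ (2 * n)) G (of_real (norm (x - y))) / of_real (norm (x - y))) = 0"
  using \<open>x \<in> U\<close>
proof (induction n arbitrary: x)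
  case 0
  then show ?case using zero by simp
next
  case (Suc n)
  have "(deriv ^^ (2 * n)) G holomorphic_on {z. Re z > 0}"
    by (intro holomorphic_higher_deriv G open_halfspace_Re_gt)
  from wint_laplacian_holomorphic[OF assms(1-3) this Suc]
  show ?case by simp
qed

text \<open>The integral \<open>h t\<close> below solves the wave equation in \<open>(x, t)\<close> with vanishing Cauchy data on
  \<open>U\<close>, and it extends holomorphically in \<open>t\<close> to the strip \<open>\<bar>Re t\<bar> < r\<close>.\<close>

lemma wint_wave_eq_0:
  assumes dim: "DIM('b) = 3"
    and U: "open U" and r: "r > 0" "\<And>x y. x \<in> U \<Longrightarrow> y \<in> D \<Longrightarrow> r \<le> norm (x - y)"
    and G: "G holomorphic_on {z. Re z > 0}"
    and zero: "\<And>x. x \<in> U \<Longrightarrow> wint (\<lambda>y. G (of_real (norm (x - y))) / of_real (norm (x - y))) = 0"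
    and x: "x \<in> U" and t: "\<bar>Re t\<bar> < r"
  shows "wint (\<lambda>y. (G (of_real (norm (x - y)) + t) + G (of_real (norm (x - y)) - t)) / of_real (norm (x - y))) = 0"
proof -
  let ?H = "{z. Re z > 0}"
  define \<rho> where "\<rho> = (\<lambda>y. complex_of_real (norm (x - y)))"
  define S where "S = {t. \<bar>Re t\<bar> < r}"
  have Seq: "S = {t. - r < Re t} \<inter> {t. Re t < r}"
    by (auto simp: S_def)
  have S: "open S" "convex S" "0 \<in> S"
    using r(1) unfolding Seq
    by (auto intro!: open_Int open_halfspace_Re_gt open_halfspace_Re_lt convex_Int convex_halfspace_Re_gt convex_halfspace_Re_lt)
  have UD: "U \<inter> D = {}"
    using r by force
  have hol: "(deriv ^^ n) G holomorphic_on ?H" for n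
    by (intro holomorphic_higher_deriv G open_halfspace_Re_gt)
  \<comment> \<open>Since \<open>\<bar>Re t\<bar> < r \<le> norm (x - y)\<close>, both arguments of
    \<open>G\<close> stay in the right half-plane, for arbitrary imaginary part of
    \<open>t\<close>.\<close>
  have pos: "0 < Re (\<rho> y + t)" "0 < Re (\<rho> y - t)" if "y \<in> D" "t \<in> S" for y t
    using r(2)[OF x that(1)] that(2) by (auto simp: \<rho>_def S_def)
  have \<rho>0: "\<rho> y \<noteq> 0" if "y \<in> D" for y
    using that UD x by (auto simp: \<rho>_def)
  have c\<rho>: "continuous_on A \<rho>" for A
    unfolding \<rho>_def by (intro continuous_intros)
  have c\<rho>2: "continuous_on A (\<lambda>p. \<rho> (snd p))" for A :: "(complex \<times> 'b) set"
    by (rule continuous_on_compose2[OF c\<rho>[of UNIV]]) (auto intro!: continuous_intros)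
  \<comment> \<open>\<open>q n\<close> is the \<open>n\<close>-th derivative of \<open>q 0\<close>
    in \<open>t\<close>, the sign coming from the chain rule for \<open>\<rho> y - t\<close>. At
    \<open>t = 0\<close> the two terms cancel for odd \<open>n\<close> and coincide for even
    \<open>n\<close>.\<close>
  define q where "q = (\<lambda>n t y. ((deriv ^^ n) G (\<rho> y + t) + (-1) ^ n * (deriv ^^ n) G (\<rho> y - t)) / \<rho> y)"
  define h where "h = (\<lambda>n t. wint (q n t))"
  have cG: "continuous_on ?H ((deriv ^^ n) G)" for n
    by (rule holomorphic_on_imp_continuous_on[OF hol])
  have cq: "continuous_on D (q n t)" if "t \<in> S" for n t
    unfolding q_def
    by (intro continuous_intros continuous_on_compose2[OF cG] c\<rho>) (use pos that \<rho>0 in auto)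
  have cq2: "continuous_on (S \<times> D) (\<lambda>(t, y). q n t y)" for n
    unfolding q_def split_beta
    by (intro continuous_intros continuous_on_compose2[OF cG] c\<rho>2) (use pos \<rho>0 in auto)
  have dG: "((deriv ^^ n) G has_field_derivative (deriv ^^ Suc n) G z) (at z)" if "Re z > 0" for n z
    using holomorphic_derivI[OF hol open_halfspace_Re_gt] that by simp
  have "(h n has_field_derivative h (Suc n) t) (at t within S)" if "t \<in> S" for n t
    unfolding h_def
  proof (rule wint_leibniz[OF _ cq cq2 that S(2)])
    fix t y assume ty: "t \<in> S" "y \<in> D"
    have "((\<lambda>t. (deriv ^^ n) G (\<rho> y + t)) has_field_derivative (deriv ^^ Suc n) G (\<rho> y + t) * 1) (at t)"
      by (rule DERIV_chain2[OF dG]) (use pos ty in \<open>auto intro!: derivative_eq_intros\<close>)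
    moreover have "((\<lambda>t. (deriv ^^ n) G (\<rho> y - t)) has_field_derivative (deriv ^^ Suc n) G (\<rho> y - t) * (-1)) (at t)"
      by (rule DERIV_chain2[OF dG]) (use pos ty in \<open>auto intro!: derivative_eq_intros\<close>)
    ultimately have "((\<lambda>t. q n t y) has_field_derivative q (Suc n) t y) (at t)"
      unfolding q_def
      by (auto intro!: derivative_eq_intros \<rho>0 ty simp: \<rho>0[OF ty(2)] simp del: funpow.simps)
    then show "((\<lambda>t. q n t y) has_field_derivative q (Suc n) t y) (at t within S)"
      by (rule has_field_derivative_at_within)
  qed
  then have dh: "(h n has_field_derivative h (Suc n) t) (at t)" if "t \<in> S" for n t
    using that S(1) by (metis at_within_open)
  have eq: "(deriv ^^ n) (h 0) t = h n t" if "t \<in> S" for n t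
    using that
  proof (induction n arbitrary: t)
    case (Suc n)
    have "deriv ((deriv ^^ n) (h 0)) t = deriv (h n) t"
      by (rule deriv_cong_ev[OF eventually_nhds_in_open[THEN eventually_mono]])
        (use S(1) Suc in auto)
    then show ?case
      using DERIV_imp_deriv[OF dh[OF Suc.prems]] by simp
  qed simp
  have h0: "h n 0 = 0" for n
  proof (cases "even n")
    case True
    then obtain k where k: "n = 2 * k" by blast
    have "h n 0 = wint (\<lambda>y. 2 * ((deriv ^^ (2 * k)) G (\<rho> y) / \<rho> y))"
      by (simp add: h_def q_def k)
    also have "\<dots> = 2 * wint (\<lambda>y. (deriv ^^ (2 * k)) G (\<rho> y) / \<rho> y)"
      by (rule wint_mult_left)
    finally show ?thesis
      using wint_higher_deriv_even[OF dim U UD G zero x] by (simp add: \<rho>_def)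
  qed (simp add: h_def q_def wint_def)
  \<comment> \<open>Identity theorem: on the connected strip \<open>S\<close>, a holomorphic
    function all of whose derivatives vanish at 0 is 0.\<close>
  have "h 0 t = 0"
  proof (rule holomorphic_fun_eq_0_on_connected[where S = S and z = 0 and f = "h 0"])
    show "h 0 holomorphic_on S"
      using dh S(1) by (auto simp: holomorphic_on_open)
    show "(deriv ^^ n) (h 0) 0 = 0" for n
      using eq[OF S(3)] h0 by simp
    show "t \<in> S"
      using t by (simp add: S_def)
  qed (use S convex_connected in auto)
  then show ?thesis
    by (simp add: h_def q_def \<rho>_def)
qed

section \<open>From resolvents to moments, and from \<open>U\<close> to the whole space\<close>

text \<open>By \<open>u^(j+1) / (u + T) = u^j - T * u^j / (u + T)\<close>, if the resolvent
  integrals with factor \<open>u^j\<close> vanish, then the \<open>j\<close>-th moment equals the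
  resolvent integral with factor \<open>u^(j+1)\<close>. This is of order \<open>1 / T\<close>, so
  the moment is 0, and then the resolvent integrals with factor \<open>u^(j+1)\<close> vanish as
  well.\<close>

lemma wint_moments_of_resolvents:
  fixes \<omega> u :: "'b \<Rightarrow> real" and T :: "nat \<Rightarrow> real"
  assumes \<omega>: "continuous_on D \<omega>" and u: "continuous_on D u" "\<And>y. y \<in> D \<Longrightarrow> u y \<ge> 0"
    and T: "\<And>n. T n > 0" "filterlim T at_top sequentially"
    and zero: "\<And>n. wint (\<lambda>y. \<omega> y / (u y + T n)) = 0"
  shows "wint (\<lambda>y. \<omega> y * u y ^ j) = 0"
proof -
  let ?K = "closure (support_on UNIV \<mu>)"
  define C where "C = integral (cbox a b) (\<lambda>y. \<bar>\<mu> y\<bar>)"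
  have ne: "u y + T n \<noteq> 0" if "y \<in> D" for y n
    using u(2)[OF that] T(1)[of n] by linarith
  have c1: "continuous_on D (\<lambda>y. \<omega> y * u y ^ j)" for j
    by (intro continuous_intros \<omega> u)
  have c2: "continuous_on D (\<lambda>y. \<omega> y * u y ^ j / (u y + T n))" for j n
    by (intro continuous_intros \<omega> u) (use ne in auto)
  have split: "wint (\<lambda>y. \<omega> y * u y ^ Suc j / (u y + T n)) =
      wint (\<lambda>y. \<omega> y * u y ^ j) - T n * wint (\<lambda>y. \<omega> y * u y ^ j / (u y + T n))" for j n
  proof -
    have "wint (\<lambda>y. \<omega> y * u y ^ Suc j / (u y + T n)) =
      wint (\<lambda>y. \<omega> y * u y ^ j - T n * (\<omega> y * u y ^ j / (u y + T n)))"
    proof (rule wint_cong)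
      fix y assume "y \<in> D"
      then show "\<omega> y * u y ^ Suc j / (u y + T n) = \<omega> y * u y ^ j - T n * (\<omega> y * u y ^ j / (u y + T n))"
        using ne[of y n] by (simp add: field_simps)
    qed
    also have "\<dots> = wint (\<lambda>y. \<omega> y * u y ^ j) - T n * wint (\<lambda>y. \<omega> y * u y ^ j / (u y + T n))"
      by (subst wint_diff) (auto intro!: continuous_on_mult_left c1 c2 simp only: wint_mult_left)
    finally show ?thesis .
  qed
  have moment: "wint (\<lambda>y. \<omega> y * u y ^ j) = 0"
    if *: "\<And>n. wint (\<lambda>y. \<omega> y * u y ^ j / (u y + T n)) = 0" for j
  proof -
    have "bounded ((\<lambda>y. \<omega> y * u y ^ Suc j) ` ?K)"
      using compact_continuous_image[OF continuous_on_subset[OF c1 support_D] compact_support]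
      by (rule compact_imp_bounded)
    then obtain B where B: "\<And>y. y \<in> ?K \<Longrightarrow> \<bar>\<omega> y * u y ^ Suc j\<bar> \<le> B"
      unfolding bounded_pos by auto
    have "norm (wint (\<lambda>y. \<omega> y * u y ^ j)) \<le> B / T n * C" for n
    proof -
      have "norm (wint (\<lambda>y. \<omega> y * u y ^ Suc j / (u y + T n))) \<le> B / T n * C"
        unfolding C_def
      proof (rule wint_bound[OF c2])
        fix y assume y: "y \<in> ?K"
        then have "u y \<ge> 0" using u(2) support_D by auto
        then show "norm (\<omega> y * u y ^ Suc j / (u y + T n)) \<le> B / T n"
          using B[OF y] T(1)[of n] unfolding real_norm_def abs_divide
          by (intro frac_le) auto
      qed
      then show ?thesis
        using split[of j n] * by simp
    qed
    moreover have "(\<lambda>n. B / T n * C) \<longlonglongrightarrow> 0"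
      by (rule tendsto_mult_left_zero[OF real_tendsto_divide_at_top[OF tendsto_const T(2)]])
    ultimately have "norm (wint (\<lambda>y. \<omega> y * u y ^ j)) \<le> 0"
      by (intro LIMSEQ_le_const) auto
    then show ?thesis by simp
  qed
  have "\<forall>n. wint (\<lambda>y. \<omega> y * u y ^ j / (u y + T n)) = 0" for j
  proof (induction j)
    case 0
    then show ?case using zero by simp
  next
    case (Suc j)
    then show ?case
      using moment[of j] by (simp only: split) simp
  qed
  then show ?thesis
    using moment by blast
qed

text \<open>On the line from a point \<open>x0\<close> of \<open>U\<close> to \<open>x\<close> the
  integral extends to an entire function of the line parameter \<open>s\<close>. It vanishes for
  small real \<open>s > 0\<close>, hence also at \<open>s = 1\<close>, which is the point
  \<open>x\<close>.\<close>

lemma wint_even_powers_extend: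
  assumes U: "open U" "U \<noteq> {}"
    and zero: "\<And>x. x \<in> U \<Longrightarrow> wint (\<lambda>y. ((norm (x - y))\<^sup>2) ^ k) = 0"
  shows "wint (\<lambda>y. ((norm (x - y))\<^sup>2) ^ k) = 0"
proof -
  obtain x0 where x0: "x0 \<in> U" using U by blast
  define v where "v = x - x0"
  \<comment> \<open>The squared distance from \<open>x0 + s *\<^sub>R v\<close> to \<open>y\<close>,
    expanded as a polynomial in \<open>s\<close> so that complex \<open>s\<close> makes
    sense.\<close>
  define P where "P = (\<lambda>(s::complex) y. of_real ((norm (x0 - y))\<^sup>2) + s * of_real (2 * ((x0 - y) \<bullet> v)) + s\<^sup>2 * of_real ((norm v)\<^sup>2))"
  define P' where "P' = (\<lambda>(s::complex) y. of_real (2 * ((x0 - y) \<bullet> v)) + 2 * s * of_real ((norm v)\<^sup>2))"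
  have P: "P (of_real s) y = of_real ((norm (x0 + s *\<^sub>R v - y))\<^sup>2)" for s y
    unfolding P_def power2_norm_eq_inner of_real_mult[symmetric] of_real_power[symmetric] of_real_add[symmetric]
    by (simp add: algebra_simps inner_commute power2_eq_square)
  have wP: "wint (\<lambda>y. P (of_real s) y ^ k) = of_real (wint (\<lambda>y. ((norm (x0 + s *\<^sub>R v - y))\<^sup>2) ^ k))" for s
    unfolding P of_real_power[symmetric] by (rule wint_of_real) (intro continuous_intros)
  have "((\<lambda>s. wint (\<lambda>y. P s y ^ k)) has_field_derivative wint (\<lambda>y. of_nat k * P s y ^ (k - 1) * P' s y)) (at s within UNIV)" for s
  proof (rule wint_leibniz)
    show "((\<lambda>s. P s y ^ k) has_field_derivative of_nat k * P s y ^ (k - 1) * P' s y) (at s)" for s y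
      unfolding P_def P'_def by (auto intro!: derivative_eq_intros)
    show "continuous_on D (\<lambda>y. P s y ^ k)" for s
      unfolding P_def by (intro continuous_intros)
    show "continuous_on (UNIV \<times> D) (\<lambda>(s, y). of_nat k * P s y ^ (k - 1) * P' s y)"
      unfolding split_beta P_def P'_def by (intro continuous_intros)
  qed auto
  then have hol: "(\<lambda>s. wint (\<lambda>y. P s y ^ k)) holomorphic_on UNIV"
    by (auto simp: holomorphic_on_open)
  have "((\<lambda>s. x0 + s *\<^sub>R v) \<longlongrightarrow> x0 + 0 *\<^sub>R v) (at (0::real))"
    by (intro tendsto_intros)
  then have "\<forall>\<^sub>F s in at (0::real). x0 + s *\<^sub>R v \<in> U"
    using x0 U(1) by (intro topological_tendstoD[of _ x0]) auto
  then obtain d where d: "d > 0" "\<And>s. s \<noteq> 0 \<Longrightarrow> \<bar>s\<bar> < d \<Longrightarrow> x0 + s *\<^sub>R v \<in> U"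
    unfolding eventually_at by (auto simp: dist_norm)
  define A where "A = complex_of_real ` {0<..<d}"
  have "wint (\<lambda>y. P 1 y ^ k) = 0"
  proof (rule analytic_continuation[OF hol, of A 0])
    show "0 islimpt A"
      unfolding islimpt_approachable
    proof (intro allI impI)
      fix e :: real assume "e > 0"
      then obtain m where "0 < m" "m < min e d"
        using d(1) dense[of 0 "min e d"] by auto
      then show "\<exists>z\<in>A. z \<noteq> 0 \<and> dist z 0 < e"
        by (intro bexI[of _ "of_real m"]) (auto simp: A_def)
    qed
    show "wint (\<lambda>y. P z y ^ k) = 0" if "z \<in> A" for z
      using that d zero by (auto simp: A_def wP)
  qed auto
  then show ?thesis
    using wP[of 1] by (simp add: v_def)
qed

section \<open>Vanishing of the density\<close>

text \<open>The integrals of all continuous functions of the squared distance to \<open>x\<close>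
  vanish. If \<open>\<mu> x\<close> were nonzero, a bump supported where \<open>\<mu>\<close> keeps
  its sign would contradict this.\<close>

lemma density_eq_0_if_even_powers:
  assumes "\<And>k. wint (\<lambda>y. ((norm (x - y))\<^sup>2) ^ k) = 0"
  shows "\<mu> x = 0"
proof (rule ccontr)
  assume nz: "\<mu> x \<noteq> 0"
  have "isCont \<mu> x"
    using continuous_density by (simp add: continuous_on_eq_continuous_at)
  then obtain e where e: "e > 0" "\<And>y. dist y x < e \<Longrightarrow> dist (\<mu> y) (\<mu> x) < \<bar>\<mu> x\<bar>"
    using nz unfolding continuous_at_eps_delta by (metis zero_less_abs_iff)
  have sign: "sgn (\<mu> x) * \<mu> y \<ge> 0" if "dist y x < e" for y
    using e(2)[OF that] nz by (cases "\<mu> x > 0") (auto simp: dist_real_def)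
  \<comment> \<open>As a function of the squared distance: positive at the centre and 0 from
    distance \<open>e\<close> on.\<close>
  define G where "G = (\<lambda>u. max 0 (e\<^sup>2 - u))"
  have cG: "continuous_on A G" for A
    unfolding G_def by (intro continuous_intros)
  define F where "F = (\<lambda>y. sgn (\<mu> x) * (G ((norm (x - y))\<^sup>2) * \<mu> y))"
  have cF: "continuous_on A F" for A
    unfolding F_def
    by (intro continuous_intros continuous_on_compose2[OF cG[of UNIV]] continuous_on_subset[OF continuous_density]) auto
  have "wint (\<lambda>y. 1 * G ((norm (x - y))\<^sup>2)) = 0"
    by (rule wint_polynomial_density[where u = "\<lambda>y. (norm (x - y))\<^sup>2"]) (use assms cG in \<open>auto intro!: continuous_intros\<close>)
  then have "integral (cbox a b) F = 0"
    by (simp add: F_def wint_def)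
  moreover have "F y \<ge> 0" for y
  proof (cases "dist y x < e")
    case True
    have "F y = G ((norm (x - y))\<^sup>2) * (sgn (\<mu> x) * \<mu> y)"
      by (simp add: F_def)
    also have "\<dots> \<ge> 0"
      by (rule mult_nonneg_nonneg[OF _ sign[OF True]]) (simp add: G_def)
    finally show ?thesis .
  next
    case False
    then have "e\<^sup>2 \<le> (norm (x - y))\<^sup>2"
      using e(1) by (intro power_mono) (auto simp: dist_norm norm_minus_commute)
    then show ?thesis
      by (simp add: F_def G_def)
  qed
  moreover have xbox: "x \<in> box a b"
    using nz density_eq_0 support_box by blast
  \<comment> \<open>A continuous nonnegative function with integral 0 vanishes on the box, whereas
    \<open>F x\<close> equals \<open>e\<^sup>2 * \<bar>\<mu> x\<bar>\<close>.\<close>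
  ultimately have "F x = 0"
    using integral_cbox_eq_0_iff[OF cF, of a b] box_subset_cbox[of a b] by blast
  then show False
    using nz e(1) by (auto simp: F_def G_def max_def sgn_0_0)
qed

lemma density_eq_0_if_potential_eq_0:
  assumes dim: "DIM('b) = 3" and U: "open U" "U \<noteq> {}"
    and r: "r > 0" "\<And>x y. x \<in> U \<Longrightarrow> y \<in> D \<Longrightarrow> r \<le> norm (x - y)"
    and \<sigma>: "\<sigma> \<ge> 0"
    and zero: "\<And>x. x \<in> U \<Longrightarrow> wint (\<lambda>y. exp (- \<sigma> * norm (x - y)) / (norm (x - y))\<^sup>2) = 0"
  shows "\<mu> x = 0"
proof -
  \<comment> \<open>For real \<open>r > 0\<close>, \<open>G r / r\<close> is the given kernel; the
    only pole of \<open>G\<close>, at 0, lies outside the open half-plane.\<close>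
  define G where "G = (\<lambda>z::complex. exp (- of_real \<sigma> * z) / z)"
  have G: "G holomorphic_on {z. Re z > 0}"
    unfolding G_def by (intro holomorphic_intros) auto
  have pos: "norm (x - y) > 0" if "x \<in> U" "y \<in> D" for x y
    using r(2)[OF that] r(1) by linarith
  have cexp: "continuous_on D (\<lambda>y. exp (- \<sigma> * norm (x - y)))" for x
    by (intro continuous_intros)
  have G0: "wint (\<lambda>y. G (of_real (norm (x - y))) / of_real (norm (x - y))) = 0" if "x \<in> U" for x
  proof -
    have "wint (\<lambda>y. G (of_real (norm (x - y))) / of_real (norm (x - y))) =
        wint (\<lambda>y. complex_of_real (exp (- \<sigma> * norm (x - y)) / (norm (x - y))\<^sup>2))"
      by (rule wint_cong) (simp add: G_def power2_eq_square flip: exp_of_real)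
    also have "\<dots> = of_real (wint (\<lambda>y. exp (- \<sigma> * norm (x - y)) / (norm (x - y))\<^sup>2))"
      by (rule wint_of_real) (use pos[OF that] in \<open>force intro!: continuous_intros\<close>)
    finally show ?thesis
      using zero[OF that] by simp
  qed
  \<comment> \<open>At zeros of the sine the two factors
    \<open>exp (\<plusminus> \<i> * \<sigma> * \<tau>)\<close> are the same nonzero real number and
    can be pulled out of the integral. \<open>Suc n\<close> avoids the value 0.\<close>
  obtain \<tau> :: "nat \<Rightarrow> real" where \<tau>: "\<And>n. \<tau> n > 0" "filterlim \<tau> at_top sequentially" "\<And>n. sin (\<sigma> * \<tau> n) = 0"
  proof (cases "\<sigma> = 0")
    case True
    show ?thesis
      by (rule that[of "\<lambda>n. real (Suc n)"])
        (use True filterlim_compose[OF filterlim_real_sequentially filterlim_Suc] in auto)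
  next
    case False
    have "filterlim (\<lambda>n. pi / \<sigma> * real (Suc n)) at_top sequentially"
      using False \<sigma> by (intro filterlim_tendsto_pos_mult_at_top[OF tendsto_const] filterlim_compose[OF filterlim_real_sequentially filterlim_Suc]) auto
    then show ?thesis
      using False \<sigma> by (intro that[of "\<lambda>n. pi / \<sigma> * real (Suc n)"])
        (auto simp: mult.commute[of pi] simp del: of_nat_Suc)
  qed
  have resolvent: "wint (\<lambda>y. exp (- \<sigma> * norm (x - y)) / ((norm (x - y))\<^sup>2 + (\<tau> n)\<^sup>2)) = 0" if x: "x \<in> U" for x n
  proof -
    define c where "c = complex_of_real (cos (\<sigma> * \<tau> n))"
    have c0: "c \<noteq> 0"
      using \<tau>(3)[of n] sin_cos_squared_add[of "\<sigma> * \<tau> n"] by (auto simp: c_def)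
    have e: "exp (\<i> * of_real (\<sigma> * \<tau> n)) = c" "exp (- (\<i> * of_real (\<sigma> * \<tau> n))) = c"
      using \<tau>(3)[of n] exp_Euler[of "of_real (\<sigma> * \<tau> n)"] exp_minus_Euler[of "of_real (\<sigma> * \<tau> n)"]
      by (simp_all add: c_def sin_of_real cos_of_real del: of_real_mult)
    have Gpm: "(G (of_real s + \<i> * of_real (\<tau> n)) + G (of_real s - \<i> * of_real (\<tau> n))) / of_real s =
        2 * c * of_real (exp (- \<sigma> * s) / (s\<^sup>2 + (\<tau> n)\<^sup>2))" if s: "s > 0" for s
    proof -
      have ex: "exp (- of_real \<sigma> * (of_real s + \<i> * of_real (\<tau> n))) = of_real (exp (- \<sigma> * s)) * c"
        unfolding e(2)[symmetric] exp_of_real[symmetric] exp_add[symmetric] by (simp add: algebra_simps)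
      have ex': "exp (- of_real \<sigma> * (of_real s - \<i> * of_real (\<tau> n))) = of_real (exp (- \<sigma> * s)) * c"
        unfolding e(1)[symmetric] exp_of_real[symmetric] exp_add[symmetric] by (simp add: algebra_simps)
      have nz: "of_real s + \<i> * of_real (\<tau> n) \<noteq> 0" "of_real s - \<i> * of_real (\<tau> n) \<noteq> 0"
        using s by (auto simp: complex_eq_iff)
      have "(of_real s + \<i> * of_real (\<tau> n)) * (of_real s - \<i> * of_real (\<tau> n)) = complex_of_real (s\<^sup>2 + (\<tau> n)\<^sup>2)"
        by (simp add: algebra_simps power2_eq_square)
      \<comment> \<open>Adding the conjugate fractions leaves \<open>2 * s\<close> in the numerator,
        and this \<open>s\<close> cancels against the division by the distance.\<close>
      then have "1 / (of_real s + \<i> * of_real (\<tau> n)) + 1 / (of_real s - \<i> * of_real (\<tau> n)) = 2 * of_real s / complex_of_real (s\<^sup>2 + (\<tau> n)\<^sup>2)"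
        using nz by (simp add: add_frac_eq)
      then have "of_real (exp (- \<sigma> * s)) * c * (1 / (of_real s + \<i> * of_real (\<tau> n)) + 1 / (of_real s - \<i> * of_real (\<tau> n))) / of_real s
          = 2 * c * of_real (exp (- \<sigma> * s) / (s\<^sup>2 + (\<tau> n)\<^sup>2))"
        using s by (simp del: of_real_add)
      then show ?thesis
        unfolding G_def ex ex' by (simp add: distrib_left del: of_real_add)
    qed
    have "0 = wint (\<lambda>y. (G (of_real (norm (x - y)) + \<i> * of_real (\<tau> n)) + G (of_real (norm (x - y)) - \<i> * of_real (\<tau> n))) / of_real (norm (x - y)))"
      by (rule wint_wave_eq_0[OF dim U(1) r G G0 x, symmetric]) (use r(1) in auto)
    also have "\<dots> = wint (\<lambda>y. 2 * c * of_real (exp (- \<sigma> * norm (x - y)) / ((norm (x - y))\<^sup>2 + (\<tau> n)\<^sup>2)))"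
      by (rule wint_cong) (rule Gpm[OF pos[OF x]])
    also have "\<dots> = 2 * c * of_real (wint (\<lambda>y. exp (- \<sigma> * norm (x - y)) / ((norm (x - y))\<^sup>2 + (\<tau> n)\<^sup>2)))"
    proof -
      have "(norm (x - y))\<^sup>2 + (\<tau> n)\<^sup>2 \<noteq> 0" for y
        using \<tau>(1)[of n] by (simp add: sum_power2_eq_zero_iff)
      then show ?thesis
        unfolding wint_mult_left by (subst wint_of_real) (auto intro!: continuous_intros)
    qed
    finally show ?thesis
      using c0 by simp
  qed
  have T: "filterlim (\<lambda>n. (\<tau> n)\<^sup>2) at_top sequentially"
    by (intro filterlim_pow_at_top \<tau>(2)) auto
  have "wint (\<lambda>y. ((norm (x - y))\<^sup>2) ^ k) = 0" if x: "x \<in> U" for x k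
  proof -
    have moments: "wint (\<lambda>y. exp (- \<sigma> * norm (x - y)) * ((norm (x - y))\<^sup>2) ^ j) = 0" for j
      by (rule wint_moments_of_resolvents[OF cexp _ _ _ T resolvent[OF x]])
        (use \<tau>(1) in \<open>auto intro!: continuous_intros simp: order_less_imp_not_eq2[OF \<tau>(1)]\<close>)
    \<comment> \<open>This choice of \<open>G\<close> removes the weight: \<open>sqrt\<close>
      recovers the distance from its square, and the exponentials cancel.\<close>
    have "wint (\<lambda>y. exp (- \<sigma> * norm (x - y)) * (exp (\<sigma> * sqrt ((norm (x - y))\<^sup>2)) * ((norm (x - y))\<^sup>2) ^ k)) = 0"
      by (rule wint_polynomial_density[OF cexp _ moments, where G = "\<lambda>u. exp (\<sigma> * sqrt u) * u ^ k"])
        (auto intro!: continuous_intros)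
    then show ?thesis
      by (simp add: mult.assoc[symmetric] flip: exp_add)
  qed
  then show ?thesis
    using wint_even_powers_extend[OF U] density_eq_0_if_even_powers by blast
qed

end

section \<open>Uniqueness through the difference of two densities\<close>

theorem theorem4p6:
  fixes \<sigma> r\<^sub>0 :: real
    and D U :: "(real^3) set"
    and \<mu>\<^sub>1 \<mu>\<^sub>2 :: "real^3 \<Rightarrow> real"
  assumes "\<sigma> \<ge> 0"
    and "is_domain D" and "bounded D"
    and "is_domain U" and "bounded U"
    and "setdist U D = r\<^sub>0" and "r\<^sub>0 > 0"
    and "\<mu>\<^sub>1 \<in> test_functions D" and "\<And>y. \<mu>\<^sub>1 y \<ge> 0"
    and "\<mu>\<^sub>2 \<in> test_functions D" and "\<And>y. \<mu>\<^sub>2 y \<ge> 0"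
    and "\<And>x. x \<in> U \<Longrightarrow> T_tilde \<sigma> \<mu>\<^sub>1 x = T_tilde \<sigma> \<mu>\<^sub>2 x"
  shows "\<mu>\<^sub>1 = \<mu>\<^sub>2"
proof
  fix x
  let ?K = "\<lambda>f. closure (support_on UNIV f)"
  define \<mu> where "\<mu> = (\<lambda>y. \<mu>\<^sub>1 y - \<mu>\<^sub>2 y)"
  have test: "continuous_on UNIV f" "compact (?K f)" "?K f \<subseteq> D" if "f \<in> test_functions D" for f
  proof -
    have "C_k 0 f"
      using that unfolding test_functions_def smooth_def by blast
    then show "continuous_on UNIV f"
      by simp
  qed (use that in \<open>auto simp: test_functions_def\<close>)
  have K: "?K \<mu> \<subseteq> ?K \<mu>\<^sub>1 \<union> ?K \<mu>\<^sub>2"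
    unfolding closure_Un[symmetric] by (rule closure_mono) (auto simp: support_on_def \<mu>_def)
  have "bounded (?K \<mu>\<^sub>1 \<union> ?K \<mu>\<^sub>2)"
    using test(2) assms by (simp add: compact_imp_bounded)
  then obtain c where c: "?K \<mu>\<^sub>1 \<union> ?K \<mu>\<^sub>2 \<subseteq> box (- c) c"
    using bounded_subset_box_symmetric by blast
  have D: "open D" and U: "open U" "U \<noteq> {}"
    using assms by (auto simp: is_domain_def)
  have dens: "compact_density f D (- c) c" if "continuous_on UNIV f" "?K f \<subseteq> ?K \<mu>\<^sub>1 \<union> ?K \<mu>\<^sub>2" for f
    using that D c test(3) assms unfolding compact_density_def by blast
  \<comment> \<open>One box serves all three densities. The interpretations for
    \<open>\<mu>\<^sub>1\<close> and \<open>\<mu>\<^sub>2\<close> supply the integrability needed to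
    split the integral against their difference.\<close>
  interpret m1: compact_density \<mu>\<^sub>1 D "- c" c
    by (rule dens) (use test assms in auto)
  interpret m2: compact_density \<mu>\<^sub>2 D "- c" c
    by (rule dens) (use test assms in auto)
  interpret compact_density \<mu> D "- c" c
    by (rule dens) (use test assms K in \<open>auto simp: \<mu>_def intro!: continuous_intros\<close>)
  have r: "r\<^sub>0 \<le> norm (x - y)" if "x \<in> U" "y \<in> D" for x y
    using setdist_le_dist[OF that] assms by (simp add: dist_norm)
  have "wint (\<lambda>y. exp (- \<sigma> * norm (x - y)) / (norm (x - y))\<^sup>2) = 0" if x: "x \<in> U" for x
  proof -
    let ?k = "\<lambda>y. exp (- \<sigma> * norm (x - y)) / (norm (x - y))\<^sup>2"
    have k: "continuous_on D ?k"
      using r[OF x] \<open>r\<^sub>0 > 0\<close> by (force intro!: continuous_intros)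
    have "wint ?k = (\<integral>y. ?k y * \<mu>\<^sub>1 y - ?k y * \<mu>\<^sub>2 y \<partial>lborel)"
      unfolding wint_eq_lborel(2)[OF k] by (simp only: \<mu>_def right_diff_distrib)
    also have "\<dots> = (\<integral>y. ?k y * \<mu>\<^sub>1 y \<partial>lborel) - (\<integral>y. ?k y * \<mu>\<^sub>2 y \<partial>lborel)"
      by (rule Bochner_Integration.integral_diff[OF m1.wint_eq_lborel(1)[OF k] m2.wint_eq_lborel(1)[OF k]])
    also have "\<dots> = 0"
      using assms(12)[OF x] by (simp add: T_tilde_def)
    finally show ?thesis .
  qed
  then have "\<mu> x = 0"
    by (intro density_eq_0_if_potential_eq_0[OF _ U _ r \<open>\<sigma> \<ge> 0\<close>]) (use \<open>r\<^sub>0 > 0\<close> in auto)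
  then show "\<mu>\<^sub>1 x = \<mu>\<^sub>2 x"
    by (simp add: \<mu>_def)
qed

end
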